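(* Let $L$ be a finite-dimensional pure, nonnilpotent, solvable Lie algebra over $\mathbb{C}$ of breadth $2$ such that $\dim[L,L]=2$ and $\dim L^k=2$ for all integers $k\geq 2$. Then $Z(L)=\{0\}$ and $C_L([L,L])$ is an abelian ideal of $L$.
   Context: For $x\in L$, $b(x)=\mathrm{rank}(\mathrm{ad}_x)$ and the breadth of $L$ is $b(L)=\max\{b(x)\mid x\in L\}$. $L$ is pure if it has no abelian ideal as a direct summand; equivalently $Z(L)\subseteq[L,L]$, where $Z(L)$ is the center. The lower central series is indexed by $L^0=L$, $L^1=[L,L]$, $L^k=[L,L^{k-1}]$ for $k\geq 2$. $C_L(S)$ denotes the centralizer of a subset $S$ in $L$. *)

theory Defs
  imports "HOL-Analysis.Analysis"
begin

text \<open>A finite-dimensional complex Lie algebra is modelled as the space complex^'n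
  (any finite index type 'n) together with a bracket operation br.\<close>

type_synonym 'n lbr = "complex ^ 'n \<Rightarrow> complex ^ 'n \<Rightarrow> complex ^ 'n"

definition lie_algebra :: "'n::finite lbr \<Rightarrow> bool" where
  "lie_algebra br \<longleftrightarrow>
     (\<forall>x. Vector_Spaces.linear (*s) (*s) (br x)) \<and>
     (\<forall>y. Vector_Spaces.linear (*s) (*s) (\<lambda>x. br x y)) \<and>
     (\<forall>x. br x x = 0) \<and>
     (\<forall>x y z. br x (br y z) + br y (br z x) + br z (br x y) = 0)"

text \<open>[A,B] = span of all brackets.\<close>
definition brs :: "'n::finite lbr \<Rightarrow> (complex^'n) set \<Rightarrow> (complex^'n) set \<Rightarrow> (complex^'n) set" where
  "brs br A B = vec.span {br a b | a b. a \<in> A \<and> b \<in> B}"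

text \<open>Lower central series: L^0 = L, L^(k+1) = [L, L^k].\<close>
fun lcs :: "'n::finite lbr \<Rightarrow> nat \<Rightarrow> (complex^'n) set" where
  "lcs br 0 = UNIV"
| "lcs br (Suc k) = brs br UNIV (lcs br k)"

text \<open>Derived series.\<close>
fun dser :: "'n::finite lbr \<Rightarrow> nat \<Rightarrow> (complex^'n) set" where
  "dser br 0 = UNIV"
| "dser br (Suc k) = brs br (dser br k) (dser br k)"

definition nilpotent_lie :: "'n::finite lbr \<Rightarrow> bool" where
  "nilpotent_lie br \<longleftrightarrow> (\<exists>k. lcs br k = {0})"

definition solvable_lie :: "'n::finite lbr \<Rightarrow> bool" where
  "solvable_lie br \<longleftrightarrow> (\<exists>k. dser br k = {0})"

definition lie_center :: "'n::finite lbr \<Rightarrow> (complex^'n) set" where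
  "lie_center br = {z. \<forall>x. br x z = 0}"

definition centralizer :: "'n::finite lbr \<Rightarrow> (complex^'n) set \<Rightarrow> (complex^'n) set" where
  "centralizer br S = {x. \<forall>s\<in>S. br x s = 0}"

definition lie_ideal :: "'n::finite lbr \<Rightarrow> (complex^'n) set \<Rightarrow> bool" where
  "lie_ideal br I \<longleftrightarrow> vec.subspace I \<and> (\<forall>x i. i \<in> I \<longrightarrow> br x i \<in> I)"

definition abelian_set :: "'n::finite lbr \<Rightarrow> (complex^'n) set \<Rightarrow> bool" where
  "abelian_set br A \<longleftrightarrow> (\<forall>a\<in>A. \<forall>b\<in>A. br a b = 0)"

text \<open>b(x) = rank of ad_x; breadth = max b(x).\<close>
definition elem_breadth :: "'n::finite lbr \<Rightarrow> complex^'n \<Rightarrow> nat" where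
  "elem_breadth br x = vec.dim (range (br x))"

definition breadth :: "'n::finite lbr \<Rightarrow> nat" where
  "breadth br = Max (range (elem_breadth br))"

text \<open>Pure: no nonzero abelian ideal is a direct summand (with complementary ideal).\<close>
definition pure_lie :: "'n::finite lbr \<Rightarrow> bool" where
  "pure_lie br \<longleftrightarrow> \<not> (\<exists>I J. lie_ideal br I \<and> lie_ideal br J \<and> I \<noteq> {0} \<and>
      abelian_set br I \<and> I \<inter> J = {0} \<and> {i + j | i j. i \<in> I \<and> j \<in> J} = UNIV)"

end

theory Submission
  imports Defs
begin

text \<open>A central element z outside [L,L] would split off the abelian ideal spanned by z, with
  a complementary hyperplane containing [L,L] as second ideal; so purity forces Z(L) \<subseteq> [L,L].
  Since L^2 \<subseteq> L^1 have the same dimension, L^2 = L^1. If L^1 = span {z, w} with z central,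
  then [L,L^1] = [L,w], hence w = [x,w] and z = [y,w] for some x, y, and the Jacobi identity for
  x, y, w yields z = 0. Thus Z(L) = 0. The Jacobi identity makes the centralizer of the ideal
  [L,L] an ideal and sends brackets of two of its elements into Z(L) = 0.\<close>

lemma line_complement_containing_subspace:
  fixes z :: "complex ^ 'n"
  assumes U: "vec.subspace U" and z: "z \<notin> U"
  obtains J where "vec.subspace J" "U \<subseteq> J" "vec.span {z} \<inter> J = {0}"
    "{i + j | i j. i \<in> vec.span {z} \<and> j \<in> J} = UNIV"
proof -
  obtain B where B: "B \<subseteq> U" "vec.independent B" "U \<subseteq> vec.span B"
    by (rule vec.maximal_independent_subset)
  have "z \<notin> vec.span B"
    using z B(1) U vec.span_minimal by blast
  then have indep: "vec.independent (insert z B)"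
    using B(2) by (simp add: vec.independent_insert)
  define g where "g = vec.construct (insert z B) (\<lambda>x. if x = z then z else 0)"
  have g: "Vector_Spaces.linear (*s) (*s) g"
    unfolding g_def using indep by (rule vec.linear_construct)
  have gz: "g z = z"
    unfolding g_def using indep by (simp add: vec.construct_basis)
  have gB: "g b = 0" if "b \<in> B" for b
    unfolding g_def using indep that z B(1) by (auto simp: vec.construct_basis)
  have "range g \<subseteq> vec.span {z}"
    unfolding g_def vec.range_construct_eq_span[OF indep]
    by (rule vec.span_minimal) (auto intro: vec.span_base vec.span_zero)
  then have g_line: "\<exists>k. g v = k *s z" for v
    by (auto simp: vec.span_singleton)
  have g_idem: "g (g v) = g v" for v
    using g_line[of v] gz vec.linear_scale[OF g] by auto
  define J where "J = {x. g x = 0}"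
  show thesis
  proof
    show "vec.subspace J"
      unfolding J_def using g by (rule vec.linear_subspace_kernel)
    show "U \<subseteq> J"
      using B(3) vec.span_minimal[of B J] gB \<open>vec.subspace J\<close> unfolding J_def by blast
    show "vec.span {z} \<inter> J = {0}"
      using gz vec.linear_scale[OF g] vec.linear_0[OF g]
      by (auto simp: J_def vec.span_singleton)
    show "{i + j | i j. i \<in> vec.span {z} \<and> j \<in> J} = UNIV"
    proof -
      have "v = g v + (v - g v)" "g v \<in> vec.span {z}" "v - g v \<in> J" for v
        using g_line[of v] g_idem[of v] vec.linear_diff[OF g]
        by (auto simp: J_def vec.span_singleton)
      then show ?thesis by blast
    qed
  qed
qed

lemma two_dim_subspace_extend_basis:
  fixes z :: "complex ^ 'n"
  assumes "vec.dim V = 2" "z \<in> V" "z \<noteq> 0"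
  shows "\<exists>w\<in>V. \<forall>u\<in>V. \<exists>k m. u = k *s z + m *s w"
proof -
  have "{z} \<subseteq> V" "vec.independent {z}"
    using assms(2,3) by (simp_all add: vec.independent_insert)
  then obtain B where B: "{z} \<subseteq> B" "B \<subseteq> V" "vec.independent B" "V \<subseteq> vec.span B"
    by (rule vec.maximal_independent_subset_extend)
  have "card B = 2"
    using vec.basis_card_eq_dim[OF B(2) B(4) B(3)] assms(1) by simp
  then obtain w where w: "B = {z, w}"
    using B(1) by (auto simp: card_2_iff)
  have "\<exists>k m. u = k *s z + m *s w" if u: "u \<in> V" for u
  proof -
    obtain k where "u - k *s z \<in> vec.span {w}"
      using u B(4) w vec.span_breakdown_eq by blast
    then obtain m where "u - k *s z = m *s w"
      by (auto simp: vec.span_singleton)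
    then have "u = k *s z + m *s w"
      by (simp add: algebra_simps)
    then show ?thesis by blast
  qed
  then show ?thesis
    using B(2) w by blast
qed

context
  fixes br :: "'n::finite lbr"
  assumes lie: "lie_algebra br"
begin

lemma bracket_linear_right: "Vector_Spaces.linear (*s) (*s) (br x)"
  using lie unfolding lie_algebra_def by blast

lemma bracket_linear_left: "Vector_Spaces.linear (*s) (*s) (\<lambda>x. br x y)"
  using lie unfolding lie_algebra_def by blast

lemma bracket_add_right: "br x (a + b) = br x a + br x b"
  using vec.linear_add[OF bracket_linear_right] .

lemma bracket_scale_right: "br x (c *s a) = c *s br x a"
  using vec.linear_scale[OF bracket_linear_right] .

lemma bracket_zero_right: "br x 0 = 0"
  using vec.linear_0[OF bracket_linear_right] .

lemma bracket_add_left: "br (a + b) y = br a y + br b y"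
  using vec.linear_add[OF bracket_linear_left[of y]] by simp

lemma bracket_scale_left: "br (c *s a) y = c *s br a y"
  using vec.linear_scale[OF bracket_linear_left[of y]] by simp

lemma bracket_zero_left: "br 0 y = 0"
  using vec.linear_0[OF bracket_linear_left[of y]] by simp

lemma bracket_self: "br x x = 0"
  using lie unfolding lie_algebra_def by blast

lemma jacobi: "br x (br y z) + br y (br z x) + br z (br x y) = 0"
  using lie unfolding lie_algebra_def by blast

lemma bracket_antisym: "br x y = - br y x"
proof -
  have "0 = br (x + y) (x + y)"
    by (rule bracket_self[symmetric])
  also have "\<dots> = br x x + br y x + (br x y + br y y)"
    by (simp only: bracket_add_left bracket_add_right)
  finally have "br x y + br y x = 0"
    by (simp add: bracket_self add.commute)
  then show ?thesis
    by (rule eq_neg_iff_add_eq_0[THEN iffD2])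
qed

lemma bracket_in_derived: "br a b \<in> lcs br 1"
  by (auto simp: brs_def intro: vec.span_base)

lemma subspace_lcs: "vec.subspace (lcs br k)"
  by (cases k) (simp_all add: brs_def)

lemma subspace_lie_center: "vec.subspace (lie_center br)"
  unfolding vec.subspace_def lie_center_def
  by (simp add: bracket_zero_right bracket_add_right bracket_scale_right)

lemma subspace_of_center_abelian_ideal:
  assumes "vec.subspace I" "I \<subseteq> lie_center br"
  shows "lie_ideal br I \<and> abelian_set br I"
  using assms vec.subspace_0[OF assms(1)]
  unfolding lie_ideal_def abelian_set_def lie_center_def by (auto simp: subset_eq)

lemma subspace_containing_derived_ideal:
  assumes "vec.subspace J" "lcs br 1 \<subseteq> J"
  shows "lie_ideal br J"
  using assms bracket_in_derived unfolding lie_ideal_def by blast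

lemma pure_center_subset_derived:
  assumes "pure_lie br"
  shows "lie_center br \<subseteq> lcs br 1"
proof
  fix z assume z: "z \<in> lie_center br"
  show "z \<in> lcs br 1"
  proof (rule ccontr)
    assume z_out: "z \<notin> lcs br 1"
    then obtain J where J: "vec.subspace J" "lcs br 1 \<subseteq> J" "vec.span {z} \<inter> J = {0}"
      "{i + j | i j. i \<in> vec.span {z} \<and> j \<in> J} = UNIV"
      by (rule line_complement_containing_subspace[OF subspace_lcs])
    have "z \<noteq> 0"
      using z_out vec.subspace_0[OF subspace_lcs[of 1]] by metis
    then have nontrivial: "vec.span {z} \<noteq> {0}"
      using vec.span_base[of z "{z}"] by auto
    have "vec.span {z} \<subseteq> lie_center br"
      using z subspace_lie_center by (simp add: vec.span_minimal)
    then have "lie_ideal br (vec.span {z}) \<and> abelian_set br (vec.span {z})"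
      by (simp add: subspace_of_center_abelian_ideal)
    moreover have "lie_ideal br J"
      using J(1,2) by (rule subspace_containing_derived_ideal)
    ultimately show False
      using assms nontrivial J(3,4) unfolding pure_lie_def by blast
  qed
qed

lemma brs_subset_derived: "brs br A B \<subseteq> lcs br 1"
  unfolding brs_def
  by (rule vec.span_minimal) (use bracket_in_derived subspace_lcs in blast)+

lemma lcs_2: "lcs br 2 = brs br UNIV (lcs br 1)"
  by (simp add: numeral_2_eq_2)

lemma lcs_2_eq_lcs_1:
  assumes "vec.dim (lcs br 2) = vec.dim (lcs br 1)"
  shows "lcs br 2 = lcs br 1"
proof (rule vec.subspace_dim_equal[OF subspace_lcs subspace_lcs])
  show "lcs br 2 \<subseteq> lcs br 1"
    unfolding lcs_2 by (rule brs_subset_derived)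
qed (use assms in simp)

lemma central_in_perfect_derived_eq_0:
  assumes perfect: "lcs br 2 = lcs br 1" and dim: "vec.dim (lcs br 1) = 2"
    and z: "z \<in> lie_center br" "z \<in> lcs br 1"
  shows "z = 0"
proof (rule ccontr)
  assume "z \<noteq> 0"
  then obtain w where w: "w \<in> lcs br 1" "\<forall>u\<in>lcs br 1. \<exists>k m. u = k *s z + m *s w"
    using two_dim_subspace_extend_basis[OF dim z(2)] by blast
  have z_central: "br x z = 0" for x
    using z(1) by (simp add: lie_center_def)
  have w_commutes: "br w u = 0" if u: "u \<in> lcs br 1" for u
  proof -
    obtain k m where "u = k *s z + m *s w"
      using w(2) u by blast
    then show ?thesis
      using z_central bracket_antisym[of w z]
      by (simp add: bracket_add_right bracket_scale_right bracket_self)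
  qed
  have brackets_in_range: "{br a b | a b. a \<in> UNIV \<and> b \<in> lcs br 1} \<subseteq> range (\<lambda>x. br x w)"
  proof (rule subsetI)
    fix u assume "u \<in> {br a b | a b. a \<in> UNIV \<and> b \<in> lcs br 1}"
    then obtain a b where u: "u = br a b" and b: "b \<in> lcs br 1"
      by blast
    obtain k m where "b = k *s z + m *s w"
      using w(2) b by blast
    then have "u = br (m *s a) w"
      by (simp add: u bracket_add_right bracket_scale_right bracket_scale_left z_central)
    then show "u \<in> range (\<lambda>x. br x w)"
      by blast
  qed
  have "lcs br 1 = brs br UNIV (lcs br 1)"
    using lcs_2 perfect by metis
  also have "\<dots> \<subseteq> range (\<lambda>x. br x w)"
    unfolding brs_def using brackets_in_range
    by (rule vec.span_minimal[OF _ vec.linear_subspace_image[OF bracket_linear_left vec.subspace_UNIV]])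
  finally have "lcs br 1 \<subseteq> range (\<lambda>x. br x w)" .
  then have "w \<in> range (\<lambda>x. br x w)" "z \<in> range (\<lambda>x. br x w)"
    using w(1) z(2) by auto
  then obtain x y where xw: "br x w = w" and yw: "br y w = z"
    by (metis rangeE)
  have "br x (br y w) = 0"
    by (simp add: yw z_central)
  moreover have "br w (br x y) = 0"
    by (rule w_commutes[OF bracket_in_derived])
  moreover have "br y (br w x) = - z"
    using bracket_antisym[of w x] xw yw vec.linear_neg[OF bracket_linear_right] by simp
  ultimately show False
    using jacobi[of x y w] \<open>z \<noteq> 0\<close> by simp
qed

lemma centralizer_ideal:
  assumes "lie_ideal br I"
  shows "lie_ideal br (centralizer br I)"
  unfolding lie_ideal_def
proof (intro conjI allI impI)
  show "vec.subspace (centralizer br I)"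
    unfolding vec.subspace_def centralizer_def
    by (simp add: bracket_zero_left bracket_add_left bracket_scale_left)
  fix x c assume c: "c \<in> centralizer br I"
  show "br x c \<in> centralizer br I"
    unfolding centralizer_def mem_Collect_eq
  proof
    fix s assume s: "s \<in> I"
    have "br s x \<in> I"
      using assms s bracket_antisym[of s x] vec.subspace_neg
      unfolding lie_ideal_def by metis
    then have "br c (br s x) = 0" "br s (br x c) = - br x (br c s)"
      using c s jacobi[of x c s] unfolding centralizer_def
      by (auto simp: add_eq_0_iff2 add.assoc)
    then show "br (br x c) s = 0"
      using c s bracket_antisym[of "br x c" s] bracket_zero_right
      unfolding centralizer_def by simp
  qed
qed

lemma bracket_centralizer_derived_central:
  assumes "c \<in> centralizer br (lcs br 1)" "d \<in> centralizer br (lcs br 1)"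
  shows "br c d \<in> lie_center br"
  unfolding lie_center_def mem_Collect_eq
proof
  fix x
  have "br c (br d x) = 0" "br d (br x c) = 0"
    using assms bracket_in_derived unfolding centralizer_def by auto
  then show "br x (br c d) = 0"
    using jacobi[of x c d] by simp
qed

end

theorem proposition3p5:
  fixes br :: "'n::finite lbr"
  assumes "lie_algebra br"
    and "pure_lie br"
    and "\<not> nilpotent_lie br"
    and "solvable_lie br"
    and "breadth br = 2"
    and "vec.dim (lcs br 1) = 2"
    and "\<forall>k\<ge>2. vec.dim (lcs br k) = 2"
  shows "lie_center br = {0} \<and> lie_ideal br (centralizer br (lcs br 1))
         \<and> abelian_set br (centralizer br (lcs br 1))"
proof -
  note lie = assms(1)
  have "lcs br 2 = lcs br 1"
    using lcs_2_eq_lcs_1[OF lie] assms(6,7) by simp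
  then have center: "lie_center br = {0}"
    using central_in_perfect_derived_eq_0[OF lie _ assms(6)]
      pure_center_subset_derived[OF lie assms(2)] vec.subspace_0[OF subspace_lie_center[OF lie]]
    by blast
  have "lie_ideal br (lcs br 1)"
    using subspace_containing_derived_ideal[OF lie subspace_lcs[OF lie]] by blast
  then have "lie_ideal br (centralizer br (lcs br 1))"
    by (rule centralizer_ideal[OF lie])
  moreover have "abelian_set br (centralizer br (lcs br 1))"
    using bracket_centralizer_derived_central[OF lie] center unfolding abelian_set_def by blast
  ultimately show ?thesis
    using center by blast
qed

end
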